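(* Let $H$ be a monoid. If $H$ is acyclic and l.f.g.u., then $H$ is FmF (and in particular atomic).
   Context: Let $H$ be a multiplicatively written monoid (not necessarily commutative) with identity $1_H$. Units and atoms. $H^\times$ is the group of units of $H$ (elements with a two-sided inverse). An atom of $H$ is an element $a \in H \setminus H^\times$ such that $a \ne xy$ for all $x,y \in H\setminus H^\times$; $\mathscr A(H)$ is the set of atoms. Write $x \simeq_H y$ if $x \in H^\times y H^\times$, and $x \mid_H y$ if $y = uxv$ for some $u,v \in H$. $H$ is acyclic if $x\ne uxv$ for all $u,v,x\in H$ with $u\notin H^\times$ or $v\notin H^\times$. Generation. For $X \subseteq H$, $\mathrm{Sgp}\langle X\rangle_H$ is the subsemigroup generated by $X$, i.e. the set of all products $x_1\cdots x_n$ with $n \ge 1$ and $x_i \in X$ (empty if $X=\emptyset$). $H$ is f.g.u. if there is a finite set $A \subseteq H$ with $H\setminus H^\times \subseteq \mathrm{Sgp}\langle H^\times A H^\times\rangle_H$, where $H^\times A H^\times = \{uav : u,v\in H^\times, a \in A\}$. A submonoid $M$ of $H$ is divisor-closed if $x \mid_H y$ and $y\in M$ imply $x \in M$. For $x\in H$, $\langle\langle x\rangle\rangle_H$ is the smallest divisor-closed submonoid of $H$ containing $x$. $H$ is l.f.g.u. if the monoid $\langle\langle x\rangle\rangle_H$ is f.g.u. for every $x\in H$. Factorizations. $\mathscr F(\mathscr A(H))$ is the free monoid on the set $\mathscr A(H)$, with operation $\ast$ (concatenation), empty word $\varepsilon$, and word length $\|\cdot\|$; $\pi_H:\mathscr F(\mathscr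 A(H))\to H$ is the monoid homomorphism with $\pi_H(a)=a$ for all $a\in\mathscr A(H)$. For $x\in H$, $\mathcal Z_H(x) := \{\mathfrak a\in\mathscr F(\mathscr A(H)) : \pi_H(\mathfrak a)=x\}$. $H$ is atomic if $\mathcal Z_H(x)\neq\emptyset$ for every $x\in H\setminus H^\times$. $\mathscr C_H$ is the congruence on $\mathscr F(\mathscr A(H))$ with $\mathfrak a \equiv\mathfrak b \bmod \mathscr C_H$ iff either $\mathfrak a=\mathfrak b=\varepsilon$, or $\mathfrak a=a_1\ast\cdots\ast a_n$ and $\mathfrak b=b_1\ast\cdots\ast b_n$ have the same length $n\ge1$, $\pi_H(\mathfrak a)=\pi_H(\mathfrak b)$, and there is a permutation $\sigma$ of $\{1,\dots,n\}$ with $a_i\simeq_H b_{\sigma(i)}$ for all $i$. $\preceq_H$ is the preorder on $\mathscr F(\mathscr A(H))$ with $\mathfrak a\preceq_H\mathfrak b$ iff either $\mathfrak a=\mathfrak b=\varepsilon$, or $\mathfrak a=a_1\ast\cdots\ast a_m$ and $\mathfrak b=b_1\ast\cdots\ast b_n$ with $m,n\ge1$, $\pi_H(\mathfrak a)=\pi_H(\mathfrak b)$, and there is an injection $\sigma:\{1,\dots,m\}\to\{1,\dots,n\}$ with $a_i\simeq_H b_{\sigma(i)}$ for all $i$. Write $\mathfrak a\prec_H\mathfrak b$ if $\mathfrak a\preceq_H\mathfrak b$ and $\mathfrak b\not\preceq_H\mathfrak a$. A word $\mathfrak a$ is $\preceq_H$-minimal if there is no $\mathfrak b\in\mathscr F(\mathscr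 A(H))$ with $\mathfrak b\prec_H\mathfrak a$. $\mathcal Z_H^{\sf m}(x)$ is the set of $\preceq_H$-minimal elements $\mathfrak a \in\mathcal Z_H(x)$, and $\mathsf Z_H^{\sf m}(x)$ is the set of $\mathscr C_H$-classes of elements of $\mathcal Z_H^{\sf m}(x)$. $H$ is FmF if $H$ is atomic and $\mathsf Z_H^{\sf m}(x)$ is finite for every $x\in H$. *)

theory Defs
  imports "HOL-Algebra.Coset" "HOL-Combinatorics.Permutations"
begin

text \<open>
  Monoids are not assumed commutative or cancellative, so divisibility is two-sided. Atoms are
  defined directly because the irreducible elements of HOL-Algebra's divisibility theory are based
  on one-sided divisibility.
\<close>

definition atoms :: "('a, 'b) monoid_scheme \<Rightarrow> 'a set" where
  "atoms H = {a \<in> carrier H - Units H.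
     \<forall>x \<in> carrier H - Units H. \<forall>y \<in> carrier H - Units H. a \<noteq> x \<otimes>\<^bsub>H\<^esub> y}"

definition unit_equiv :: "('a, 'b) monoid_scheme \<Rightarrow> 'a \<Rightarrow> 'a \<Rightarrow> bool" where
  "unit_equiv H x y \<longleftrightarrow> (\<exists>u \<in> Units H. \<exists>v \<in> Units H. x = u \<otimes>\<^bsub>H\<^esub> y \<otimes>\<^bsub>H\<^esub> v)"

definition two_sided_dvd :: "('a, 'b) monoid_scheme \<Rightarrow> 'a \<Rightarrow> 'a \<Rightarrow> bool" where
  "two_sided_dvd H x y \<longleftrightarrow>
     (\<exists>u \<in> carrier H. \<exists>v \<in> carrier H. y = u \<otimes>\<^bsub>H\<^esub> x \<otimes>\<^bsub>H\<^esub> v)"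

definition acyclic_monoid :: "('a, 'b) monoid_scheme \<Rightarrow> bool" where
  "acyclic_monoid H \<longleftrightarrow>
     (\<forall>u \<in> carrier H. \<forall>v \<in> carrier H. \<forall>x \<in> carrier H.
        u \<notin> Units H \<or> v \<notin> Units H \<longrightarrow> x \<noteq> u \<otimes>\<^bsub>H\<^esub> x \<otimes>\<^bsub>H\<^esub> v)"

definition word_prod :: "('a, 'b) monoid_scheme \<Rightarrow> 'a list \<Rightarrow> 'a" where
  "word_prod H w = foldr (\<otimes>\<^bsub>H\<^esub>) w \<one>\<^bsub>H\<^esub>"

definition Sgp :: "('a, 'b) monoid_scheme \<Rightarrow> 'a set \<Rightarrow> 'a set" where
  "Sgp H X = {word_prod H w | w. w \<in> lists X \<and> w \<noteq> []}"

definition fgu :: "('a, 'b) monoid_scheme \<Rightarrow> bool" where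
  "fgu H \<longleftrightarrow> (\<exists>A \<subseteq> carrier H. finite A \<and>
     carrier H - Units H \<subseteq> Sgp H (Units H <#>\<^bsub>H\<^esub> A <#>\<^bsub>H\<^esub> Units H))"

definition divisor_closed_submonoid :: "'a set \<Rightarrow> ('a, 'b) monoid_scheme \<Rightarrow> bool" where
  "divisor_closed_submonoid M H \<longleftrightarrow>
     submonoid M H \<and> (\<forall>x \<in> carrier H. \<forall>y \<in> M. two_sided_dvd H x y \<longrightarrow> x \<in> M)"

definition divisor_closure :: "('a, 'b) monoid_scheme \<Rightarrow> 'a \<Rightarrow> 'a set" where
  "divisor_closure H x = \<Inter>{M. divisor_closed_submonoid M H \<and> x \<in> M}"

text \<open>The intersection is indeed the smallest divisor-closed submonoid containing \<open>x\<close>.\<close>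

lemma divisor_closure_smallest:
  assumes "monoid H" "x \<in> carrier H"
  shows "divisor_closed_submonoid (divisor_closure H x) H"
    and "x \<in> divisor_closure H x"
    and "divisor_closed_submonoid M H \<Longrightarrow> x \<in> M \<Longrightarrow> divisor_closure H x \<subseteq> M"
proof -
  interpret monoid H by fact
  let ?F = "{M. divisor_closed_submonoid M H \<and> x \<in> M}"
  have "submonoid (carrier H) H"
    by unfold_locales simp_all
  then have "carrier H \<in> ?F"
    using assms(2) by (simp add: divisor_closed_submonoid_def)
  then have "\<Inter>?F \<subseteq> carrier H"
    by (rule Inter_lower)
  moreover have sub: "submonoid M H" if "M \<in> ?F" for M
    using that by (simp add: divisor_closed_submonoid_def)
  ultimately have "submonoid (\<Inter>?F) H"
    by (intro submonoid.intro InterI)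
       (blast intro: submonoid.m_closed submonoid.one_closed)+
  moreover have "y \<in> \<Inter>?F"
    if "y \<in> carrier H" "z \<in> \<Inter>?F" "two_sided_dvd H y z" for y z
    using that unfolding divisor_closed_submonoid_def by blast
  ultimately show "divisor_closed_submonoid (divisor_closure H x) H"
    unfolding divisor_closure_def divisor_closed_submonoid_def[of "\<Inter>?F"] by blast
  show "x \<in> divisor_closure H x"
    unfolding divisor_closure_def by blast
  show "divisor_closure H x \<subseteq> M" if "divisor_closed_submonoid M H" "x \<in> M"
    unfolding divisor_closure_def using that by blast
qed

text \<open>
  The divisor-closed submonoid is regarded as a monoid in its own right: units and generators in
  \<^const>\<open>fgu\<close> are taken inside it.
\<close>

definition lfgu :: "('a, 'b) monoid_scheme \<Rightarrow> bool" where
  "lfgu H \<longleftrightarrow> (\<forall>x \<in> carrier H. fgu (H\<lparr>carrier := divisor_closure H x\<rparr>))"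

text \<open>
  The free monoid on the atoms consists of the lists in \<open>lists (atoms H)\<close>. Letters are indexed
  from \<open>0\<close>.
\<close>

definition factorizations :: "('a, 'b) monoid_scheme \<Rightarrow> 'a \<Rightarrow> 'a list set" where
  "factorizations H x = {a \<in> lists (atoms H). word_prod H a = x}"

definition atomic_monoid :: "('a, 'b) monoid_scheme \<Rightarrow> bool" where
  "atomic_monoid H \<longleftrightarrow> (\<forall>x \<in> carrier H - Units H. factorizations H x \<noteq> {})"

definition fact_cong :: "('a, 'b) monoid_scheme \<Rightarrow> ('a list \<times> 'a list) set" where
  "fact_cong H = {(a, b). a \<in> lists (atoms H) \<and> b \<in> lists (atoms H) \<and>
     (a = [] \<and> b = [] \<or>
      a \<noteq> [] \<and> length a = length b \<and> word_prod H a = word_prod H b \<and>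
      (\<exists>\<sigma>. \<sigma> permutes {..<length a} \<and> (\<forall>i < length a. unit_equiv H (a ! i) (b ! \<sigma> i))))}"

text \<open>
  The empty word is related only to itself, even though in general a nonempty word of atoms may
  have product \<open>\<one>\<close>.
\<close>

definition fact_le :: "('a, 'b) monoid_scheme \<Rightarrow> 'a list \<Rightarrow> 'a list \<Rightarrow> bool" where
  "fact_le H a b \<longleftrightarrow> a \<in> lists (atoms H) \<and> b \<in> lists (atoms H) \<and>
     (a = [] \<and> b = [] \<or>
      a \<noteq> [] \<and> b \<noteq> [] \<and> word_prod H a = word_prod H b \<and>
      (\<exists>\<sigma>. inj_on \<sigma> {..<length a} \<and> \<sigma> ` {..<length a} \<subseteq> {..<length b} \<and>
           (\<forall>i < length a. unit_equiv H (a ! i) (b ! \<sigma> i))))"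

definition fact_less :: "('a, 'b) monoid_scheme \<Rightarrow> 'a list \<Rightarrow> 'a list \<Rightarrow> bool" where
  "fact_less H a b \<longleftrightarrow> fact_le H a b \<and> \<not> fact_le H b a"

definition min_factorizations :: "('a, 'b) monoid_scheme \<Rightarrow> 'a \<Rightarrow> 'a list set" where
  "min_factorizations H x =
     {a \<in> factorizations H x. \<not> (\<exists>b \<in> lists (atoms H). fact_less H b a)}"

definition min_factorization_classes :: "('a, 'b) monoid_scheme \<Rightarrow> 'a \<Rightarrow> 'a list set set" where
  "min_factorization_classes H x = min_factorizations H x // fact_cong H"

definition FmF :: "('a, 'b) monoid_scheme \<Rightarrow> bool" where
  "FmF H \<longleftrightarrow> atomic_monoid H \<and> (\<forall>x \<in> carrier H. finite (min_factorization_classes H x))"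

end

theory Submission
  imports Defs Complex_Main
begin

text \<open>
  Fix \<open>x\<close> and a divisor-closed submonoid \<open>M\<close> containing it that is generated, up to units, by a finite
  set \<open>A\<close>. Since \<open>M\<close> is divisor-closed, it has the units of the whole monoid, and every factor of an
  element of \<open>M\<close> lies in \<open>M\<close>. Hence there is no need to treat \<open>M\<close> as a monoid of its own: units, atoms
  and factorizations can all be taken in the ambient monoid.
  
  Atomicity. A generator \<open>a\<close> that is neither a unit nor an atom is a product of two nonunits \<open>y\<close> and
  \<open>z\<close>. By acyclicity \<open>a\<close> divides neither of them, so the generators occurring in \<open>y\<close> and \<open>z\<close> strictly
  divide \<open>a\<close>. Strict divisibility on the finite set \<open>A\<close> is well-founded, and by induction every
  generator is a unit or a product of atoms (\<open>generator_factorable\<close>); so the same holds for every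
  element of \<open>M\<close>.
  
  Finiteness. An atom of \<open>M\<close> written as a product of translates of generators is a unit translate of
  one of them, because whenever an atom is split into two factors, one of these is a unit
  (\<open>atom_classes_subset_generators\<close>). So only finitely many classes of atoms modulo units occur in the
  factorizations of \<open>x\<close>. The multiset of these classes determines a factorization of \<open>x\<close> up to
  congruence, and proper inclusion of multisets makes the smaller nonempty factorization strictly
  smaller in the preorder. The multisets of minimal factorizations therefore form an antichain over a
  finite alphabet, apart from the empty one, and Dickson's lemma (\<open>finite_multiset_antichain\<close>) shows
  that there are only finitely many.
\<close>

section \<open>Dickson's lemma for multisets\<close>

lemma incseq_subsequence_nat:
  fixes s :: "nat \<Rightarrow> nat"
  shows "\<exists>g. strict_mono g \<and> incseq (\<lambda>n. s (g n))"
proof -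
  obtain g where g: "strict_mono (g :: nat \<Rightarrow> nat)" "monoseq (\<lambda>n. s (g n))"
    using seq_monosub by blast
  show ?thesis
  proof (cases "incseq (\<lambda>n. s (g n))")
    case True
    with g show ?thesis by blast
  next
    case False
    then have dec: "decseq (\<lambda>n. s (g n))"
      using g(2) by (simp add: monoseq_iff)
    \<comment> \<open>A nonincreasing sequence of naturals is constant from the point where it attains its minimum.\<close>
    define N where "N = (ARG_MIN (\<lambda>n. s (g n)) n. True)"
    have N: "s (g N) \<le> s (g n)" for n
      unfolding N_def by (rule arg_min_nat_le) simp
    have "s (g (n + N)) = s (g N)" for n
      using N[of "n + N"] decseqD[OF dec, of N "n + N"] by simp
    then have "incseq (\<lambda>n. s (g (n + N)))"
      by (simp add: incseq_def)
    moreover have "strict_mono (\<lambda>n. g (n + N))"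
      using g(1) by (simp add: strict_mono_def)
    ultimately show ?thesis by blast
  qed
qed

lemma incseq_subsequence_finite_family:
  fixes f :: "nat \<Rightarrow> 'k \<Rightarrow> nat"
  assumes "finite K"
  shows "\<exists>g. strict_mono g \<and> (\<forall>k\<in>K. incseq (\<lambda>n. f (g n) k))"
  using assms
proof (induction K)
  case empty
  show ?case using strict_mono_id by blast
next
  case (insert k K)
  then obtain g where g: "strict_mono g" "\<forall>k\<in>K. incseq (\<lambda>n. f (g n) k)" by blast
  obtain h where h: "strict_mono h" "incseq (\<lambda>n. f (g (h n)) k)"
    using incseq_subsequence_nat[of "\<lambda>n. f (g n) k"] by blast
  have "incseq (\<lambda>n. f (g (h n)) j)" if "j \<in> K" for j
    using g(2) that h(1) by (simp add: incseq_def strict_mono_less_eq)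
  moreover have "strict_mono (\<lambda>n. g (h n))"
    using g(1) h(1) by (simp add: strict_mono_def)
  ultimately show ?case using h(2) by (intro exI[of _ "\<lambda>n. g (h n)"]) auto
qed

text \<open>
  An infinite set would contain a sequence of distinct multisets. Passing to a subsequence along which
  the multiplicity of every letter is nondecreasing makes its terms comparable.
\<close>

lemma finite_multiset_antichain:
  assumes K: "finite K" "\<And>M. M \<in> S \<Longrightarrow> set_mset M \<subseteq> K"
    and anti: "\<And>M N. M \<in> S \<Longrightarrow> N \<in> S \<Longrightarrow> \<not> M \<subset># N"
  shows "finite S"
proof (rule ccontr)
  assume "infinite S"
  then obtain f :: "nat \<Rightarrow> 'a multiset" where f: "inj f" "range f \<subseteq> S"
    using infinite_countable_subset by blast
  obtain g where g: "strict_mono g" "\<forall>k\<in>K. incseq (\<lambda>n. count (f (g n)) k)"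
    using incseq_subsequence_finite_family[OF K(1), of "\<lambda>n. count (f n)"] by blast
  have "count (f (g 0)) k \<le> count (f (g 1)) k" for k
  proof (cases "k \<in> K")
    case True
    with g(2) show ?thesis by (simp add: incseq_def)
  next
    case False
    then have "k \<notin># f (g 0)" using K(2)[of "f (g 0)"] f(2) by blast
    then show ?thesis by (simp add: not_in_iff)
  qed
  then have "f (g 0) \<subseteq># f (g 1)" by (rule mset_subset_eqI)
  moreover have "g 0 \<noteq> g 1" using strict_monoD[OF g(1), of 0 1] by simp
  then have "f (g 0) \<noteq> f (g 1)" using f(1) by (simp add: inj_eq)
  ultimately show False
    using anti[of "f (g 0)" "f (g 1)"] f(2) by (auto simp: subset_mset_def)
qed

section \<open>Equivalence modulo units and divisibility\<close>

definition unit_class :: "('a, 'b) monoid_scheme \<Rightarrow> 'a \<Rightarrow> 'a set" where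
  "unit_class H x = {y \<in> carrier H. unit_equiv H x y}"

text \<open>
  The invariant through which both the congruence and the preorder on factorizations of a fixed
  element are expressed: permutations and injections between words that respect equivalence modulo
  units become equality and inclusion of these multisets.
\<close>

definition class_content :: "('a, 'b) monoid_scheme \<Rightarrow> 'a list \<Rightarrow> 'a set multiset" where
  "class_content H w = mset (map (unit_class H) w)"

context monoid
begin

lemma atoms_carrier: "q \<in> atoms G \<Longrightarrow> q \<in> carrier G"
  by (simp add: atoms_def)

lemma word_prod_Nil [simp]: "word_prod G [] = \<one>"
  by (simp add: word_prod_def)

lemma word_prod_Cons [simp]: "word_prod G (x # w) = x \<otimes> word_prod G w"
  by (simp add: word_prod_def)

lemma word_prod_closed: "set w \<subseteq> carrier G \<Longrightarrow> word_prod G w \<in> carrier G"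
  by (induction w) auto

lemma word_prod_append:
  "set v \<subseteq> carrier G \<Longrightarrow> set w \<subseteq> carrier G \<Longrightarrow>
    word_prod G (v @ w) = word_prod G v \<otimes> word_prod G w"
  by (induction v) (auto simp: m_assoc word_prod_closed)

lemma Units_cancel_both:
  assumes "u \<in> Units G" "v \<in> Units G" "y \<in> carrier G"
  shows "inv u \<otimes> (u \<otimes> y \<otimes> v) \<otimes> inv v = y"
proof -
  have c: "u \<in> carrier G" "v \<in> carrier G" "inv u \<in> carrier G" "inv v \<in> carrier G"
    using assms by auto
  have "inv u \<otimes> (u \<otimes> y \<otimes> v) \<otimes> inv v = (inv u \<otimes> u) \<otimes> y \<otimes> (v \<otimes> inv v)"
    using c assms(3) by (simp only: m_assoc m_closed)
  then show ?thesis using assms by simp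
qed

lemma unit_equiv_refl: "x \<in> carrier G \<Longrightarrow> unit_equiv G x x"
  unfolding unit_equiv_def by (intro bexI[of _ \<one>]) auto

lemma unit_equiv_sym:
  assumes "y \<in> carrier G" "unit_equiv G x y"
  shows "unit_equiv G y x"
proof -
  obtain u v where "u \<in> Units G" "v \<in> Units G" "x = u \<otimes> y \<otimes> v"
    using assms(2) unfolding unit_equiv_def by blast
  then have "y = inv u \<otimes> x \<otimes> inv v" "inv u \<in> Units G" "inv v \<in> Units G"
    using Units_cancel_both assms(1) by auto
  then show ?thesis unfolding unit_equiv_def by blast
qed

lemma unit_equiv_trans:
  assumes "z \<in> carrier G" "unit_equiv G x y" "unit_equiv G y z"
  shows "unit_equiv G x z"
proof -
  obtain u v where uv: "u \<in> Units G" "v \<in> Units G" "x = u \<otimes> y \<otimes> v"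
    using assms(2) unfolding unit_equiv_def by blast
  obtain s t where st: "s \<in> Units G" "t \<in> Units G" "y = s \<otimes> z \<otimes> t"
    using assms(3) unfolding unit_equiv_def by blast
  have "x = (u \<otimes> s) \<otimes> z \<otimes> (t \<otimes> v)"
    using uv st assms(1) by (simp add: m_assoc Units_closed)
  moreover have "u \<otimes> s \<in> Units G" "t \<otimes> v \<in> Units G" using uv st by auto
  ultimately show ?thesis unfolding unit_equiv_def by blast
qed

lemma unit_class_eq_iff:
  assumes "x \<in> carrier G" "y \<in> carrier G"
  shows "unit_class G x = unit_class G y \<longleftrightarrow> unit_equiv G x y"
proof
  assume "unit_class G x = unit_class G y"
  then show "unit_equiv G x y"
    using assms unit_equiv_refl[of y] by (auto simp: unit_class_def)
next
  assume "unit_equiv G x y"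
  then show "unit_class G x = unit_class G y"
    using assms unfolding unit_class_def
    by (blast intro: unit_equiv_sym unit_equiv_trans)
qed

lemma two_sided_dvd_trans:
  assumes x: "x \<in> carrier G" and "two_sided_dvd G x y" "two_sided_dvd G y z"
  shows "two_sided_dvd G x z"
proof -
  obtain u v where uv: "u \<in> carrier G" "v \<in> carrier G" "y = u \<otimes> x \<otimes> v"
    using assms(2) unfolding two_sided_dvd_def by blast
  obtain s t where st: "s \<in> carrier G" "t \<in> carrier G" "z = s \<otimes> y \<otimes> t"
    using assms(3) unfolding two_sided_dvd_def by blast
  have "z = (s \<otimes> u) \<otimes> x \<otimes> (v \<otimes> t)" using uv st x by (simp add: m_assoc)
  then show ?thesis using uv st unfolding two_sided_dvd_def by blast
qed

lemma two_sided_dvd_refl: "x \<in> carrier G \<Longrightarrow> two_sided_dvd G x x"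
  unfolding two_sided_dvd_def by (intro bexI[of _ \<one>]) auto

lemma factors_two_sided_dvd:
  assumes "x \<in> carrier G" "y \<in> carrier G"
  shows "two_sided_dvd G x (x \<otimes> y)" "two_sided_dvd G y (x \<otimes> y)"
proof -
  have "x \<otimes> y = \<one> \<otimes> x \<otimes> y" "x \<otimes> y = x \<otimes> y \<otimes> \<one>"
    using assms by simp_all
  then show "two_sided_dvd G x (x \<otimes> y)" "two_sided_dvd G y (x \<otimes> y)"
    using assms one_closed unfolding two_sided_dvd_def by blast+
qed

lemma unit_equiv_two_sided_dvd: "unit_equiv G x y \<Longrightarrow> two_sided_dvd G y x"
  unfolding unit_equiv_def two_sided_dvd_def by blast

lemma letter_two_sided_dvd_word_prod:
  "set w \<subseteq> carrier G \<Longrightarrow> l \<in> set w \<Longrightarrow> two_sided_dvd G l (word_prod G w)"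
proof (induction w)
  case Nil
  then show ?case by simp
next
  case (Cons x w)
  have c: "x \<in> carrier G" "word_prod G w \<in> carrier G" "l \<in> carrier G"
    using Cons.prems by (auto intro: word_prod_closed)
  show ?case
  proof (cases "l = x")
    case True
    then show ?thesis using factors_two_sided_dvd(1) c by simp
  next
    case False
    then have "two_sided_dvd G l (word_prod G w)" using Cons by simp
    then show ?thesis
      using two_sided_dvd_trans[OF c(3)] factors_two_sided_dvd(2)[OF c(1,2)] by simp
  qed
qed

section \<open>Acyclic monoids\<close>

lemma acyclicD:
  assumes "acyclic_monoid G" "u \<in> carrier G" "v \<in> carrier G" "x \<in> carrier G"
    "x = u \<otimes> x \<otimes> v"
  shows "u \<in> Units G" "v \<in> Units G"
  using assms unfolding acyclic_monoid_def by blast+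

text \<open>
  If \<open>x \<otimes> y\<close> is a unit with inverse \<open>i\<close>, then \<open>\<one> = x \<otimes> \<one> \<otimes> (y \<otimes> i)\<close> and \<open>\<one> = (i \<otimes> x) \<otimes> \<one> \<otimes> y\<close> are
  cycles through \<open>\<one>\<close>.
\<close>

lemma acyclic_unit_factors:
  assumes ac: "acyclic_monoid G" and c: "x \<in> carrier G" "y \<in> carrier G"
    and xy: "x \<otimes> y \<in> Units G"
  shows "x \<in> Units G" "y \<in> Units G"
proof -
  have i: "inv (x \<otimes> y) \<in> carrier G" using xy by simp
  have "\<one> = x \<otimes> \<one> \<otimes> (y \<otimes> inv (x \<otimes> y))"
    using c i Units_r_inv[OF xy] by (simp add: m_assoc)
  then show "x \<in> Units G"
    using acyclicD(1)[OF ac c(1) m_closed[OF c(2) i] one_closed] by blast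
  have "\<one> = (inv (x \<otimes> y) \<otimes> x) \<otimes> \<one> \<otimes> y"
    using c i Units_l_inv[OF xy] by (simp add: m_assoc)
  then show "y \<in> Units G"
    using acyclicD(2)[OF ac m_closed[OF i c(1)] c(2) one_closed] by blast
qed

text \<open>
  If \<open>x \<otimes> y\<close> divided \<open>x\<close>, say with outer factors \<open>p\<close> and \<open>q\<close>, then \<open>x = p \<otimes> x \<otimes> (y \<otimes> q)\<close>, and
  acyclicity makes \<open>y \<otimes> q\<close> and hence \<open>y\<close> a unit. The other claim is symmetric.
\<close>

lemma proper_factor_not_dvd:
  assumes ac: "acyclic_monoid G" and c: "x \<in> carrier G" "y \<in> carrier G"
    and nu: "x \<notin> Units G" "y \<notin> Units G"
  shows "\<not> two_sided_dvd G (x \<otimes> y) x" "\<not> two_sided_dvd G (x \<otimes> y) y"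
proof -
  show "\<not> two_sided_dvd G (x \<otimes> y) x"
  proof
    assume "two_sided_dvd G (x \<otimes> y) x"
    then obtain p q where pq: "p \<in> carrier G" "q \<in> carrier G" "x = p \<otimes> (x \<otimes> y) \<otimes> q"
      unfolding two_sided_dvd_def by blast
    then have "x = p \<otimes> x \<otimes> (y \<otimes> q)" using c by (simp add: m_assoc)
    then have "y \<otimes> q \<in> Units G" using acyclicD(2)[OF ac] pq c by blast
    then show False using acyclic_unit_factors(1)[OF ac] c pq nu by blast
  qed
  show "\<not> two_sided_dvd G (x \<otimes> y) y"
  proof
    assume "two_sided_dvd G (x \<otimes> y) y"
    then obtain p q where pq: "p \<in> carrier G" "q \<in> carrier G" "y = p \<otimes> (x \<otimes> y) \<otimes> q"
      unfolding two_sided_dvd_def by blast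
    then have "y = (p \<otimes> x) \<otimes> y \<otimes> q" using c by (simp add: m_assoc)
    then have "p \<otimes> x \<in> Units G" using acyclicD(1)[OF ac] pq c by blast
    then show False using acyclic_unit_factors(2)[OF ac] c pq nu by blast
  qed
qed

section \<open>Unit translates of atoms\<close>

lemma Units_mult_equiv:
  assumes "u \<in> Units G" "x \<in> carrier G"
  shows "unit_equiv G (u \<otimes> x) x" "unit_equiv G (x \<otimes> u) x"
proof -
  have "u \<otimes> x = u \<otimes> x \<otimes> \<one>" "x \<otimes> u = \<one> \<otimes> x \<otimes> u"
    using assms by (auto simp: Units_closed)
  then show "unit_equiv G (u \<otimes> x) x" "unit_equiv G (x \<otimes> u) x"
    using assms(1) Units_one_closed unfolding unit_equiv_def by blast+
qed

lemma unit_equiv_Units: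
  assumes "y \<in> carrier G" "unit_equiv G x y" "x \<in> Units G"
  shows "y \<in> Units G"
proof -
  obtain u v where uv: "u \<in> Units G" "v \<in> Units G" "y = u \<otimes> x \<otimes> v"
    using unit_equiv_sym[OF assms(1,2)] unfolding unit_equiv_def by blast
  then show ?thesis using assms(3) by auto
qed

lemma unit_equiv_atom:
  assumes q: "q \<in> atoms G" and r: "r \<in> carrier G" "unit_equiv G r q"
  shows "r \<in> atoms G"
proof -
  have qc: "q \<in> carrier G" and qn: "q \<notin> Units G"
    and irr: "\<And>x y. x \<in> carrier G - Units G \<Longrightarrow> y \<in> carrier G - Units G \<Longrightarrow> q \<noteq> x \<otimes> y"
    using q by (auto simp: atoms_def)
  obtain u v where uv: "u \<in> Units G" "v \<in> Units G" "q = u \<otimes> r \<otimes> v"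
    using unit_equiv_sym[OF qc r(2)] unfolding unit_equiv_def by blast
  have "r \<notin> Units G" using unit_equiv_Units[OF qc r(2)] qn by blast
  moreover have "r \<noteq> x \<otimes> y" if x: "x \<in> carrier G - Units G" and y: "y \<in> carrier G - Units G" for x y
  proof
    assume "r = x \<otimes> y"
    then have "q = (u \<otimes> x) \<otimes> (y \<otimes> v)" using uv x y by (simp add: m_assoc Units_closed)
    moreover have "unit_equiv G (u \<otimes> x) x" "unit_equiv G (y \<otimes> v) y"
      using uv x y Units_mult_equiv by auto
    then have "u \<otimes> x \<notin> Units G" "y \<otimes> v \<notin> Units G"
      using unit_equiv_Units x y by blast+
    ultimately show False using irr[of "u \<otimes> x" "y \<otimes> v"] uv x y by auto
  qed
  ultimately show ?thesis using r(1) by (simp add: atoms_def)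
qed

section \<open>Existence of factorizations\<close>

text \<open>
  Units and products of atoms together are closed under multiplication because a unit next to a
  nonempty product of atoms can be absorbed into the neighbouring atom.
\<close>

lemma factorable_mult:
  assumes "x \<in> Units G \<union> word_prod G ` lists (atoms G)"
    and "y \<in> Units G \<union> word_prod G ` lists (atoms G)"
  shows "x \<otimes> y \<in> Units G \<union> word_prod G ` lists (atoms G)"
proof -
  have sub: "set w \<subseteq> carrier G" if "w \<in> lists (atoms G)" for w
    using that atoms_carrier by auto
  consider "x \<in> Units G" "y \<in> Units G"
    | v where "x \<in> Units G" "v \<in> lists (atoms G)" "y = word_prod G v"
    | w where "y \<in> Units G" "w \<in> lists (atoms G)" "x = word_prod G w"
    | v w where "v \<in> lists (atoms G)" "x = word_prod G v" "w \<in> lists (atoms G)" "y = word_prod G w"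
    using assms by blast
  then show ?thesis
  proof cases
    case 1
    then show ?thesis by auto
  next
    case (2 v)
    show ?thesis
    proof (cases v)
      case Nil
      with 2 show ?thesis by simp
    next
      case (Cons q t)
      have q: "q \<in> atoms G" "q \<in> carrier G" "t \<in> lists (atoms G)"
        using 2(2) Cons atoms_carrier by auto
      have "x \<otimes> q \<in> atoms G"
        using unit_equiv_atom[OF q(1)] Units_mult_equiv(1)[OF 2(1) q(2)] 2(1) q(2) by auto
      then have "(x \<otimes> q) # t \<in> lists (atoms G)" using q(3) by simp
      moreover have "x \<otimes> y = word_prod G ((x \<otimes> q) # t)"
        using 2 Cons q sub[OF q(3)] by (simp add: m_assoc word_prod_closed Units_closed)
      ultimately show ?thesis by blast
    qed
  next
    case (3 w)
    show ?thesis
    proof (cases w rule: rev_cases)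
      case Nil
      with 3 show ?thesis by simp
    next
      case (snoc t q)
      have q: "q \<in> atoms G" "q \<in> carrier G" "t \<in> lists (atoms G)"
        using 3(2) snoc atoms_carrier by auto
      have "q \<otimes> y \<in> atoms G"
        using unit_equiv_atom[OF q(1)] Units_mult_equiv(2)[OF 3(1) q(2)] 3(1) q(2) by auto
      then have "t @ [q \<otimes> y] \<in> lists (atoms G)" using q(3) by simp
      moreover have "x \<otimes> y = word_prod G (t @ [q \<otimes> y])"
        using 3 snoc q sub[OF q(3)] by (simp add: m_assoc word_prod_closed word_prod_append Units_closed)
      ultimately show ?thesis by blast
    qed
  next
    case (4 v w)
    then have "x \<otimes> y = word_prod G (v @ w)" using sub word_prod_append by simp
    moreover have "v @ w \<in> lists (atoms G)" using 4 by simp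
    ultimately show ?thesis by blast
  qed
qed

lemma factorable_word_prod:
  assumes "set w \<subseteq> Units G \<union> word_prod G ` lists (atoms G)"
  shows "word_prod G w \<in> Units G \<union> word_prod G ` lists (atoms G)"
  using assms
proof (induction w)
  case Nil
  show ?case by simp
next
  case (Cons l w)
  then have "l \<otimes> word_prod G w \<in> Units G \<union> word_prod G ` lists (atoms G)"
    by (intro factorable_mult) simp_all
  then show ?case by (simp only: word_prod_Cons)
qed

lemma factorable_unit_equiv:
  assumes "b \<in> Units G \<union> word_prod G ` lists (atoms G)" "unit_equiv G l b"
  shows "l \<in> Units G \<union> word_prod G ` lists (atoms G)"
proof -
  obtain u v where uv: "u \<in> Units G" "v \<in> Units G" "l = u \<otimes> b \<otimes> v"
    using assms(2) unfolding unit_equiv_def by blast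
  show ?thesis
    unfolding uv(3) by (intro factorable_mult assms(1) UnI1 uv(1,2))
qed

lemma Sgp_letters:
  assumes "A \<subseteq> carrier G" "x \<in> Sgp G (Units G <#> A <#> Units G)"
  obtains w where "set w \<subseteq> carrier G" "x = word_prod G w"
    "\<And>l. l \<in> set w \<Longrightarrow> \<exists>b\<in>A. unit_equiv G l b"
proof -
  obtain w where w: "w \<in> lists (Units G <#> A <#> Units G)" "x = word_prod G w"
    using assms(2) unfolding Sgp_def by blast
  have "l \<in> carrier G \<and> (\<exists>b\<in>A. unit_equiv G l b)" if l: "l \<in> set w" for l
  proof -
    obtain u b v where "u \<in> Units G" "v \<in> Units G" "b \<in> A" "l = u \<otimes> b \<otimes> v"
      using w(1) l unfolding set_mult_def by (auto simp: in_lists_conv_set)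
    then show ?thesis using assms(1) unfolding unit_equiv_def by auto
  qed
  then show thesis using that w(2) by blast
qed

text \<open>
  The induction is on the number of generators dividing \<open>a\<close>. It works because the generators that
  occur in a proper factor of \<open>a\<close> divide \<open>a\<close> but are not divided by it.
\<close>

lemma generator_factorable:
  assumes ac: "acyclic_monoid G" and M: "divisor_closed_submonoid M G"
    and A: "A \<subseteq> M" "finite A"
    and gen: "M - Units G \<subseteq> Sgp G (Units G <#> A <#> Units G)"
  shows "a \<in> A \<Longrightarrow> a \<in> Units G \<union> word_prod G ` lists (atoms G)"
proof (induction a rule: measure_induct_rule[where f = "\<lambda>a. card {c \<in> A. two_sided_dvd G c a}"])
  case (less a)
  have Mc: "M \<subseteq> carrier G"
    using M by (simp add: divisor_closed_submonoid_def submonoid.subset)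
  then have Ac: "A \<subseteq> carrier G" using A(1) by blast
  have ac': "a \<in> carrier G" "a \<in> M" using less.prems Ac A(1) by auto
  have factor: "z \<in> Units G \<union> word_prod G ` lists (atoms G)"
    if z: "z \<in> carrier G" "z \<notin> Units G" "two_sided_dvd G z a" "\<not> two_sided_dvd G a z" for z
  proof -
    have "z \<in> M"
      using M z ac' unfolding divisor_closed_submonoid_def by blast
    then have "z \<in> Sgp G (Units G <#> A <#> Units G)" using gen z(2) by blast
    then obtain w where w: "set w \<subseteq> carrier G" "z = word_prod G w"
      "\<And>l. l \<in> set w \<Longrightarrow> \<exists>b\<in>A. unit_equiv G l b"
      using Sgp_letters[OF Ac] by blast
    have "l \<in> Units G \<union> word_prod G ` lists (atoms G)" if l: "l \<in> set w" for l
    proof -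
      obtain b where b: "b \<in> A" "unit_equiv G l b" using w(3) l by blast
      have bc: "b \<in> carrier G" using b Ac by blast
      have bz: "two_sided_dvd G b z"
        using two_sided_dvd_trans[OF bc unit_equiv_two_sided_dvd[OF b(2)]]
          letter_two_sided_dvd_word_prod[OF w(1) l] w(2) by blast
      have "{c \<in> A. two_sided_dvd G c b} \<subset> {c \<in> A. two_sided_dvd G c a}"
      proof
        show "{c \<in> A. two_sided_dvd G c b} \<subseteq> {c \<in> A. two_sided_dvd G c a}"
          using two_sided_dvd_trans bz z(3) Ac by blast
        have "\<not> two_sided_dvd G a b"
          using two_sided_dvd_trans[OF ac'(1) _ bz] z(4) by blast
        then show "{c \<in> A. two_sided_dvd G c b} \<noteq> {c \<in> A. two_sided_dvd G c a}"
          using less.prems two_sided_dvd_refl[OF ac'(1)] by blast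
      qed
      then have "card {c \<in> A. two_sided_dvd G c b} < card {c \<in> A. two_sided_dvd G c a}"
        using A(2) by (intro psubset_card_mono) auto
      then show ?thesis using less.IH b factorable_unit_equiv by blast
    qed
    then show ?thesis using factorable_word_prod w(2) by blast
  qed
  show ?case
  proof (cases "a \<in> Units G \<or> a \<in> atoms G")
    case True
    moreover have "a \<in> word_prod G ` lists (atoms G)" if "a \<in> atoms G"
      using that ac' by (intro image_eqI[of _ _ "[a]"]) simp_all
    ultimately show ?thesis by blast
  next
    case False
    then obtain x y where xy: "x \<in> carrier G" "y \<in> carrier G" "x \<notin> Units G" "y \<notin> Units G"
      "a = x \<otimes> y" using ac' unfolding atoms_def by blast
    then have "x \<in> Units G \<union> word_prod G ` lists (atoms G)"
      "y \<in> Units G \<union> word_prod G ` lists (atoms G)"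
      using factor factors_two_sided_dvd proper_factor_not_dvd[OF ac xy(1-4)] by blast+
    then show ?thesis using factorable_mult xy(5) by blast
  qed
qed

section \<open>Atoms as products of generators\<close>

text \<open>
  In an atom \<open>x \<otimes> p\<close> one of the factors is a unit: either \<open>p\<close>, and then \<open>x\<close> is the required letter, or
  \<open>x\<close>, and then \<open>p\<close> is an atom equivalent to \<open>x \<otimes> p\<close>, to which the induction applies.
\<close>

lemma atom_eq_word_prod:
  shows "set w \<subseteq> carrier G \<Longrightarrow> word_prod G w \<in> atoms G \<Longrightarrow>
    \<exists>l\<in>set w. unit_equiv G (word_prod G w) l"
proof (induction w)
  case Nil
  then show ?case by (simp add: atoms_def)
next
  case (Cons x w)
  let ?p = "word_prod G w"
  have c: "x \<in> carrier G" "?p \<in> carrier G" using Cons.prems by (auto intro: word_prod_closed)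
  consider "?p \<in> Units G" | "x \<in> Units G"
    using Cons.prems c by (force simp: atoms_def)
  then show ?case
  proof cases
    case 1
    then show ?thesis using Units_mult_equiv(2)[OF 1 c(1)] by simp
  next
    case 2
    have e: "unit_equiv G (x \<otimes> ?p) ?p" using Units_mult_equiv(1)[OF 2 c(2)] .
    then have "?p \<in> atoms G"
      using unit_equiv_atom[OF Cons.prems(2) c(2)] unit_equiv_sym[OF c(2)] by simp
    then obtain l where l: "l \<in> set w" "unit_equiv G ?p l" using Cons by auto
    then have "unit_equiv G (x \<otimes> ?p) l" using unit_equiv_trans[OF _ e l(2)] Cons.prems(1) by auto
    then show ?thesis using l(1) by auto
  qed
qed

lemma atom_classes_subset_generators:
  assumes A: "A \<subseteq> carrier G"
    and gen: "M - Units G \<subseteq> Sgp G (Units G <#> A <#> Units G)"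
  shows "unit_class G ` (atoms G \<inter> M) \<subseteq> unit_class G ` A"
proof
  fix C assume "C \<in> unit_class G ` (atoms G \<inter> M)"
  then obtain q where q: "q \<in> atoms G" "q \<in> M" "C = unit_class G q" by blast
  then have "q \<in> Sgp G (Units G <#> A <#> Units G)" using gen by (auto simp: atoms_def)
  then obtain w where w: "set w \<subseteq> carrier G" "q = word_prod G w"
    "\<And>l. l \<in> set w \<Longrightarrow> \<exists>b\<in>A. unit_equiv G l b"
    using Sgp_letters[OF A] by blast
  obtain l where "l \<in> set w" "unit_equiv G q l"
    using atom_eq_word_prod[OF w(1)] q(1) w(2) by blast
  then obtain b where "b \<in> A" "unit_equiv G q b"
    using w(3) unit_equiv_trans A by blast
  then show "C \<in> unit_class G ` A"
    using unit_class_eq_iff[OF atoms_carrier[OF q(1)]] A q(3) by blast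
qed

section \<open>Transfer from divisor-closed submonoids\<close>

lemma divisor_closed_Units_subset:
  assumes "divisor_closed_submonoid M G"
  shows "Units G \<subseteq> M"
proof
  fix u assume u: "u \<in> Units G"
  then have "two_sided_dvd G u \<one>"
    unfolding two_sided_dvd_def
    by (intro bexI[of _ \<one>] bexI[of _ "inv u"]) auto
  moreover have "\<one> \<in> M"
    using assms by (simp add: divisor_closed_submonoid_def submonoid.one_closed)
  ultimately show "u \<in> M" using assms u unfolding divisor_closed_submonoid_def by auto
qed

lemma Units_divisor_closed_submonoid:
  assumes "divisor_closed_submonoid M G"
  shows "Units (G\<lparr>carrier := M\<rparr>) = Units G"
proof
  have Mc: "M \<subseteq> carrier G"
    using assms by (simp add: divisor_closed_submonoid_def submonoid.subset)
  then show "Units (G\<lparr>carrier := M\<rparr>) \<subseteq> Units G" by (auto simp: Units_def)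
  show "Units G \<subseteq> Units (G\<lparr>carrier := M\<rparr>)"
  proof
    fix u assume u: "u \<in> Units G"
    then have "u \<in> M" "inv u \<in> M"
      using divisor_closed_Units_subset[OF assms] by auto
    then show "u \<in> Units (G\<lparr>carrier := M\<rparr>)"
      using u by (auto simp: Units_def[of "G\<lparr>carrier := M\<rparr>"] intro!: bexI[of _ "inv u"])
  qed
qed

lemma fgu_divisor_closed_submonoid:
  assumes M: "divisor_closed_submonoid M G" and f: "fgu (G\<lparr>carrier := M\<rparr>)"
  obtains A where "A \<subseteq> M" "finite A" "M - Units G \<subseteq> Sgp G (Units G <#> A <#> Units G)"
proof -
  let ?H = "G\<lparr>carrier := M\<rparr>"
  have wp: "word_prod ?H = word_prod G" by (simp add: word_prod_def fun_eq_iff)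
  have Sgp: "Sgp ?H X = Sgp G X" for X by (simp add: Sgp_def wp)
  have sm: "X <#>\<^bsub>?H\<^esub> Y = X <#> Y" for X Y by (simp add: set_mult_def)
  show thesis
    using f that unfolding fgu_def by (auto simp: Sgp sm Units_divisor_closed_submonoid[OF M])
qed

section \<open>Minimal factorizations\<close>

lemma fact_cong_iff:
  assumes a: "a \<in> lists (atoms G)" and b: "b \<in> lists (atoms G)"
  shows "(a, b) \<in> fact_cong G \<longleftrightarrow>
    word_prod G a = word_prod G b \<and> class_content G a = class_content G b"
proof -
  have ca: "a ! i \<in> carrier G" if "i < length a" for i using a that atoms_carrier by auto
  have cb: "b ! i \<in> carrier G" if "i < length b" for i using b that atoms_carrier by auto
  show ?thesis
  proof
    assume "(a, b) \<in> fact_cong G"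
    then consider "a = []" "b = []"
      | \<sigma> where "length a = length b" "word_prod G a = word_prod G b"
        "\<sigma> permutes {..<length a}" "\<forall>i < length a. unit_equiv G (a ! i) (b ! \<sigma> i)"
      unfolding fact_cong_def by blast
    then show "word_prod G a = word_prod G b \<and> class_content G a = class_content G b"
    proof cases
      case 1
      then show ?thesis by simp
    next
      case (2 \<sigma>)
      have "map (unit_class G) a = permute_list \<sigma> (map (unit_class G) b)"
      proof (rule nth_equalityI)
        fix i assume i: "i < length (map (unit_class G) a)"
        then have "\<sigma> i < length b" using permutes_in_image[OF 2(3), of i] 2(1) by auto
        then show "map (unit_class G) a ! i = permute_list \<sigma> (map (unit_class G) b) ! i"
          using i 2 ca[of i] cb[of "\<sigma> i"] by (simp add: permute_list_nth unit_class_eq_iff)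
      qed (use 2 in simp)
      moreover have "mset (permute_list \<sigma> (map (unit_class G) b)) = mset (map (unit_class G) b)"
        using 2(1,3) by (intro mset_permute_list) simp
      ultimately show ?thesis using 2(2) unfolding class_content_def by simp
    qed
  next
    assume r: "word_prod G a = word_prod G b \<and> class_content G a = class_content G b"
    then obtain \<sigma> where s: "\<sigma> permutes {..<length (map (unit_class G) b)}"
      "permute_list \<sigma> (map (unit_class G) b) = map (unit_class G) a"
      using mset_eq_permutation unfolding class_content_def by metis
    have len: "length a = length b" using arg_cong[OF s(2), of length] by simp
    have "unit_equiv G (a ! i) (b ! \<sigma> i)" if i: "i < length a" for i
    proof -
      have "\<sigma> i < length b" using permutes_in_image[OF s(1), of i] i len by auto
      moreover have "unit_class G (a ! i) = unit_class G (b ! \<sigma> i)"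
        using arg_cong[OF s(2), of "\<lambda>l. l ! i"] permute_list_nth[OF s(1), of i] i len
          calculation by simp
      ultimately show ?thesis using ca[OF i] cb unit_class_eq_iff by blast
    qed
    then show "(a, b) \<in> fact_cong G"
      using a b r len s(1) unfolding fact_cong_def by auto
  qed
qed

text \<open>
  Completing \<open>a\<close> by the missing classes to a word with the content of \<open>b\<close> yields a permutation, whose
  restriction to the positions of \<open>a\<close> is the required injection. Strictness holds because \<open>b\<close> is
  longer than \<open>a\<close>. The word \<open>a\<close> must be nonempty since the empty word lies below no other word.
\<close>

lemma fact_less_if_class_content_less:
  assumes a: "a \<in> lists (atoms G)" "a \<noteq> []" and b: "b \<in> lists (atoms G)"
    and p: "word_prod G a = word_prod G b"
    and less: "class_content G a \<subset># class_content G b"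
  shows "fact_less G a b"
proof -
  have ca: "a ! i \<in> carrier G" if "i < length a" for i using a that atoms_carrier by auto
  have cb: "b ! i \<in> carrier G" if "i < length b" for i using b that atoms_carrier by auto
  have len: "length a < length b"
    using mset_subset_size[OF less] by (simp add: class_content_def)
  obtain c where "class_content G b = class_content G a + mset c"
    using less by (metis ex_mset subset_mset.less_imp_le mset_subset_eq_exists_conv)
  then have "mset (map (unit_class G) a @ c) = mset (map (unit_class G) b)"
    by (simp add: class_content_def)
  then obtain \<sigma> where s: "\<sigma> permutes {..<length (map (unit_class G) b)}"
    "permute_list \<sigma> (map (unit_class G) b) = map (unit_class G) a @ c"
    using mset_eq_permutation by metis
  have in_b: "\<sigma> i < length b" if "i < length b" for i
    using permutes_in_image[OF s(1), of i] that by auto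
  have "unit_equiv G (a ! i) (b ! \<sigma> i)" if i: "i < length a" for i
  proof -
    have "unit_class G (a ! i) = unit_class G (b ! \<sigma> i)"
      using arg_cong[OF s(2), of "\<lambda>l. l ! i"] permute_list_nth[OF s(1), of i] i len in_b[of i]
      by (simp add: nth_append)
    then show ?thesis using ca[OF i] cb in_b[of i] i len unit_class_eq_iff by simp
  qed
  moreover have "inj_on \<sigma> {..<length a}"
    using permutes_inj[OF s(1)] by (rule inj_on_subset) simp
  moreover have "\<sigma> ` {..<length a} \<subseteq> {..<length b}" using in_b len by auto
  ultimately have "fact_le G a b"
    using a b p len unfolding fact_le_def by auto
  moreover have "\<not> fact_le G b a"
  proof
    assume "fact_le G b a"
    then obtain \<tau> where "inj_on \<tau> {..<length b}" "\<tau> ` {..<length b} \<subseteq> {..<length a}"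
      using a(2) unfolding fact_le_def by blast
    then have "card {..<length b} \<le> card {..<length a}" by (intro card_inj_on_le) auto
    then show False using len by simp
  qed
  ultimately show ?thesis unfolding fact_less_def by blast
qed

text \<open>
  By minimality no content of a nonempty minimal factorization properly contains another one, so
  Dickson's lemma bounds the number of contents, and each of them belongs to only one congruence class
  of factorizations of \<open>x\<close>.
\<close>

lemma finite_min_factorization_classes:
  assumes K: "finite K" "\<And>w l. w \<in> factorizations G x \<Longrightarrow> l \<in> set w \<Longrightarrow> unit_class G l \<in> K"
  shows "finite (min_factorization_classes G x)"
proof -
  let ?Z = "min_factorizations G x"
  have Z: "w \<in> lists (atoms G)" "word_prod G w = x" "w \<in> factorizations G x" if "w \<in> ?Z" for w
    using that by (auto simp: min_factorizations_def factorizations_def)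
  have "finite (class_content G ` (?Z - {[]}))"
  proof (rule finite_multiset_antichain[OF K(1)])
    show "set_mset M \<subseteq> K" if M: "M \<in> class_content G ` (?Z - {[]})" for M
    proof -
      obtain w where "w \<in> ?Z" "M = class_content G w" using M by blast
      then show ?thesis using K(2)[OF Z(3)] by (auto simp: class_content_def)
    qed
    show "\<not> M \<subset># N" if MN: "M \<in> class_content G ` (?Z - {[]})"
      "N \<in> class_content G ` (?Z - {[]})" for M N
    proof
      assume lt: "M \<subset># N"
      obtain a b where ab: "a \<in> ?Z" "a \<noteq> []" "M = class_content G a"
        "b \<in> ?Z" "N = class_content G b"
        using MN by blast
      then have "fact_less G a b"
        using fact_less_if_class_content_less[of a b] Z lt by simp
      then show False using ab Z(1)[OF ab(1)] by (auto simp: min_factorizations_def)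
    qed
  qed
  moreover have "class_content G ` ?Z \<subseteq> insert {#} (class_content G ` (?Z - {[]}))"
    by (auto simp: class_content_def)
  ultimately have fin: "finite (class_content G ` ?Z)"
    using finite_subset by blast
  have "fact_cong G `` {a} =
      {b \<in> lists (atoms G). word_prod G b = x \<and> class_content G b = class_content G a}"
    if "a \<in> ?Z" for a
  proof (rule Set.set_eqI)
    fix b
    have "(a, b) \<in> fact_cong G \<longleftrightarrow>
        b \<in> lists (atoms G) \<and> word_prod G a = word_prod G b \<and> class_content G a = class_content G b"
    proof (cases "b \<in> lists (atoms G)")
      case True
      with fact_cong_iff[OF Z(1)[OF that]] show ?thesis by simp
    next
      case False
      then show ?thesis unfolding fact_cong_def by blast
    qed
    then show "b \<in> fact_cong G `` {a} \<longleftrightarrow>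
        b \<in> {b \<in> lists (atoms G). word_prod G b = x \<and> class_content G b = class_content G a}"
      using Z(2)[OF that] by (simp only: Image_singleton_iff mem_Collect_eq) metis
  qed
  then have "min_factorization_classes G x \<subseteq>
      (\<lambda>M. {b \<in> lists (atoms G). word_prod G b = x \<and> class_content G b = M}) ` class_content G ` ?Z"
    unfolding min_factorization_classes_def quotient_def by auto
  then show ?thesis using fin finite_subset by blast
qed

lemma lfgu_generators:
  assumes "lfgu G" "x \<in> carrier G"
  obtains M A where "divisor_closed_submonoid M G" "x \<in> M" "A \<subseteq> M" "finite A"
    "M - Units G \<subseteq> Sgp G (Units G <#> A <#> Units G)"
proof -
  note dc = divisor_closure_smallest(1,2)[OF monoid_axioms assms(2)]
  have "fgu (G\<lparr>carrier := divisor_closure G x\<rparr>)"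
    using assms unfolding lfgu_def by blast
  then obtain A where "A \<subseteq> divisor_closure G x" "finite A"
    "divisor_closure G x - Units G \<subseteq> Sgp G (Units G <#> A <#> Units G)"
    by (rule fgu_divisor_closed_submonoid[OF dc(1)])
  then show thesis by (rule that[OF dc])
qed

section \<open>Locally finitely generated monoids\<close>

lemma acyclic_lfgu_atomic:
  assumes ac: "acyclic_monoid G" and lf: "lfgu G"
  shows "atomic_monoid G"
  unfolding atomic_monoid_def
proof
  fix x assume x: "x \<in> carrier G - Units G"
  then obtain M A where M: "divisor_closed_submonoid M G" "x \<in> M" "A \<subseteq> M" "finite A"
    "M - Units G \<subseteq> Sgp G (Units G <#> A <#> Units G)"
    using lfgu_generators[OF lf] by blast
  have Ac: "A \<subseteq> carrier G"
    using M(1,3) by (auto simp: divisor_closed_submonoid_def dest: submonoid.subset)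
  have "x \<in> Sgp G (Units G <#> A <#> Units G)" using M(2,5) x by blast
  then obtain w where w: "x = word_prod G w" "\<And>l. l \<in> set w \<Longrightarrow> \<exists>b\<in>A. unit_equiv G l b"
    using Sgp_letters[OF Ac] by blast
  have "set w \<subseteq> Units G \<union> word_prod G ` lists (atoms G)"
    using w(2) generator_factorable[OF ac M(1,3,4,5)] factorable_unit_equiv by blast
  then have "x \<in> word_prod G ` lists (atoms G)"
    using factorable_word_prod w(1) x by blast
  then show "factorizations G x \<noteq> {}" by (auto simp: factorizations_def)
qed

lemma acyclic_lfgu_finite_min_factorization_classes:
  assumes ac: "acyclic_monoid G" and lf: "lfgu G" and x: "x \<in> carrier G"
  shows "finite (min_factorization_classes G x)"
proof -
  obtain M A where M: "divisor_closed_submonoid M G" "x \<in> M" "A \<subseteq> M" "finite A"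
    "M - Units G \<subseteq> Sgp G (Units G <#> A <#> Units G)"
    using lfgu_generators[OF lf x] by blast
  have Ac: "A \<subseteq> carrier G"
    using M(1,3) by (auto simp: divisor_closed_submonoid_def dest: submonoid.subset)
  show ?thesis
  proof (rule finite_min_factorization_classes)
    show "finite (unit_class G ` A)" using M(4) by simp
    fix w l assume w: "w \<in> factorizations G x" and l: "l \<in> set w"
    have wa: "set w \<subseteq> atoms G" "word_prod G w = x" using w by (auto simp: factorizations_def)
    have wc: "set w \<subseteq> carrier G" using wa(1) atoms_carrier by blast
    have "l \<in> M"
      using letter_two_sided_dvd_word_prod[OF wc l] wa(2) M(1,2) wc l
      unfolding divisor_closed_submonoid_def by blast
    then show "unit_class G l \<in> unit_class G ` A"
      using atom_classes_subset_generators[OF Ac M(5)] wa(1) l by blast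
  qed
qed

end

theorem corollary4p12:
  fixes H :: "('a, 'b) monoid_scheme"
  assumes "monoid H" and "acyclic_monoid H" and "lfgu H"
  shows "FmF H \<and> atomic_monoid H"
proof -
  interpret monoid H by fact
  show ?thesis
    unfolding FmF_def
    using acyclic_lfgu_atomic acyclic_lfgu_finite_min_factorization_classes assms(2,3) by blast
qed

end
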